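(* Let $Y$ be a graph on $n\geq 3$ vertices. The graph $\mathsf{FS}(\mathsf{Lollipop}_{n-3,3},Y)$ is connected if and only if the minimum degree of $Y$ is at least $n-2$.
   Context: All graphs are finite and simple; $[n]=\{1,\ldots,n\}$. For graphs $X,Y$ with $|V(X)|=|V(Y)|$, the friends-and-strangers graph $\mathsf{FS}(X,Y)$ has as vertices all bijections $\sigma\colon V(X)\to V(Y)$; two bijections $\sigma,\sigma'$ are adjacent iff there is an edge $\{a,b\}\in E(X)$ with $\{\sigma(a),\sigma(b)\}\in E(Y)$, $\sigma(a)=\sigma'(b)$, $\sigma(b)=\sigma'(a)$, and $\sigma(c)=\sigma'(c)$ for all $c\in V(X)\setminus\{a,b\}$. The lollipop graph $\mathsf{Lollipop}_{k,m}$ has vertex set $[k+m]$ and edge set $\{\{i,i+1\}:1\leq i\leq k\}\cup\{\{i,j\}:k+1\leq i<j\leq k+m\}$. *)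

theory Defs
  imports "Graph_Theory.Digraph_Component" "HOL-Library.FuncSet"
begin

text \<open>
  A finite simple graph is a \<open>pair_graph\<close>: a finite, symmetric and loop-free set of
  ordered pairs of vertices, so that the edge \<open>{u, v}\<close> stands for the two arcs \<open>(u, v)\<close>
  and \<open>(v, u)\<close>. In particular the out-degree of a vertex is its degree.
\<close>

text \<open>Only meaningful for a finite nonempty vertex set, as \<^const>\<open>Min\<close> is.\<close>

definition min_degree :: "'a pair_pre_digraph \<Rightarrow> nat" where
  "min_degree G = Min (out_degree (with_proj G) ` pverts G)"

text \<open>
  For \<open>m = 0\<close> and \<open>k > 0\<close> the edge \<open>{k, k + 1}\<close> leaves the vertex set; the lollipop graph
  is meant for \<open>m \<ge> 1\<close>.
\<close>

definition Lollipop :: "nat \<Rightarrow> nat \<Rightarrow> nat pair_pre_digraph" where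
  "Lollipop k m =
     (let E = {(i, i + 1) | i. 1 \<le> i \<and> i \<le> k}
            \<union> {(i, j). k + 1 \<le> i \<and> i < j \<and> j \<le> k + m}
      in \<lparr> pverts = {1..k + m}, parcs = E \<union> E\<inverse> \<rparr>)"

text \<open>
  Restricting to \<^const>\<open>extensional\<close> functions makes each bijection between the two vertex
  sets exactly one vertex: values outside \<open>V(X)\<close> cannot tell two functions apart.
\<close>

definition bijections :: "'a set \<Rightarrow> 'b set \<Rightarrow> ('a \<Rightarrow> 'b) set" where
  "bijections A B = {\<sigma> \<in> extensional A. bij_betw \<sigma> A B}"

definition FS :: "'a pair_pre_digraph \<Rightarrow> 'b pair_pre_digraph \<Rightarrow> ('a \<Rightarrow> 'b) pair_pre_digraph" where
  "FS X Y =
     \<lparr> pverts = bijections (pverts X) (pverts Y),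
       parcs = {(\<sigma>, \<sigma>').
         \<sigma> \<in> bijections (pverts X) (pverts Y) \<and> \<sigma>' \<in> bijections (pverts X) (pverts Y) \<and>
         (\<exists>a b. (a, b) \<in> parcs X \<and> (\<sigma> a, \<sigma> b) \<in> parcs Y \<and>
            \<sigma> a = \<sigma>' b \<and> \<sigma> b = \<sigma>' a \<and>
            (\<forall>c \<in> pverts X - {a, b}. \<sigma> c = \<sigma>' c))} \<rparr>"

lemma pair_graph_Lollipop:
  assumes "m \<ge> 1"
  shows "pair_graph (Lollipop k m)"
proof -
  have "parcs (Lollipop k m) \<subseteq> {1..k + m} \<times> {1..k + m}"
    using assms by (auto simp: Lollipop_def Let_def)
  then have "finite (parcs (Lollipop k m))"
    by (rule finite_subset) simp
  then show ?thesis
    using assms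
    by unfold_locales (auto simp: Lollipop_def Let_def symmetric_def sym_def)
qed

lemma finite_bijections:
  assumes "finite A" "finite B"
  shows "finite (bijections A B)"
proof (rule finite_subset)
  show "bijections A B \<subseteq> A \<rightarrow>\<^sub>E B"
    by (auto simp: bijections_def PiE_def dest: bij_betwE)
  show "finite (A \<rightarrow>\<^sub>E B)"
    using assms by (simp add: finite_PiE)
qed

lemma pair_graph_FS:
  assumes "pair_graph X" "pair_graph Y"
  shows "pair_graph (FS X Y)"
proof -
  interpret X: pair_graph X by fact
  interpret Y: pair_graph Y by fact
  have fin: "finite (bijections (pverts X) (pverts Y))"
    by (simp add: finite_bijections)
  have "parcs (FS X Y)
      \<subseteq> bijections (pverts X) (pverts Y) \<times> bijections (pverts X) (pverts Y)"
    by (auto simp: FS_def)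
  then have fina: "finite (parcs (FS X Y))"
    using fin by (meson finite_SigmaI finite_subset)
  have symX: "(b, a) \<in> parcs X" if "(a, b) \<in> parcs X" for a b
    using X.pair_sym_arcs that by (auto simp: symmetric_def sym_def)
  have sym: "(\<sigma>', \<sigma>) \<in> parcs (FS X Y)" if "(\<sigma>, \<sigma>') \<in> parcs (FS X Y)" for \<sigma> \<sigma>'
  proof -
    from that obtain a b where "(a, b) \<in> parcs X" "(\<sigma> a, \<sigma> b) \<in> parcs Y"
        "\<sigma> a = \<sigma>' b" "\<sigma> b = \<sigma>' a" "\<forall>c \<in> pverts X - {a, b}. \<sigma> c = \<sigma>' c"
      by (auto simp: FS_def)
    with symX[of a b] have "(b, a) \<in> parcs X \<and> (\<sigma>' b, \<sigma>' a) \<in> parcs Y \<and>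
        \<sigma>' b = \<sigma> a \<and> \<sigma>' a = \<sigma> b \<and> (\<forall>c \<in> pverts X - {b, a}. \<sigma>' c = \<sigma> c)"
      by auto
    then have "\<exists>a b. (a, b) \<in> parcs X \<and> (\<sigma>' a, \<sigma>' b) \<in> parcs Y \<and>
        \<sigma>' a = \<sigma> b \<and> \<sigma>' b = \<sigma> a \<and> (\<forall>c \<in> pverts X - {a, b}. \<sigma>' c = \<sigma> c)"
      by blast
    moreover have "\<sigma> \<in> bijections (pverts X) (pverts Y)" "\<sigma>' \<in> bijections (pverts X) (pverts Y)"
      using that by (simp_all add: FS_def)
    ultimately show ?thesis
      by (simp add: FS_def)
  qed
  have loopfree: "\<sigma> \<noteq> \<sigma>'" if "(\<sigma>, \<sigma>') \<in> parcs (FS X Y)" for \<sigma> \<sigma>'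
  proof -
    from that obtain a b where "(\<sigma> a, \<sigma> b) \<in> parcs Y" "\<sigma> a = \<sigma>' b" "\<sigma> b = \<sigma>' a"
      unfolding FS_def by auto
    with Y.pair_no_loops[of "(\<sigma> a, \<sigma> b)"] show ?thesis
      by auto
  qed
  show ?thesis
  proof
    fix e assume "e \<in> parcs (FS X Y)"
    then show "fst e \<in> pverts (FS X Y)" "snd e \<in> pverts (FS X Y)" "fst e \<noteq> snd e"
      using loopfree by (cases e; auto simp: FS_def)+
  next
    show "finite (pverts (FS X Y))" using fin by (simp add: FS_def)
    show "finite (parcs (FS X Y))" by (rule fina)
    show "symmetric (with_proj (FS X Y))"
      using sym by (auto simp: symmetric_def intro: symI)
  qed
qed

end

theory Submission
  imports Defs "HOL-Combinatorics.Permutations"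
begin

text \<open>
  People, the vertices of \<open>Y\<close>, stand on the positions of a path of \<open>n\<close> vertices whose last three
  positions form a triangle; two neighbours may trade places if they are friends, that is, adjacent
  in \<open>Y\<close>. The degree condition says that nobody has two strangers.

  If \<open>y\<close> has two strangers \<open>a\<close> and \<open>b\<close>, then a stranger can pass \<open>y\<close> only in the triangle, where
  the third corner serves to step aside. Suppose that \<open>y\<close> stands at the first corner or further left
  and that both \<open>a\<close> and \<open>b\<close> are to the right of \<open>y\<close>. Once \<open>y\<close> reaches the first corner, \<open>a\<close> and
  \<open>b\<close> occupy the other two, and \<open>y\<close> can only go back. So this set of arrangements is never left
  (\<open>left_of_strangers_closed\<close>), and it is neither empty nor everything.

  Conversely, let everybody have at most one stranger. It suffices to exchange any two neighbours on
  the path, leaving everybody else in place: these transpositions generate all permutations. Friends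
  are exchanged by a single move. Two strangers are both friends of any third person, who can
  therefore walk through the pair. At the end of the path the third corner of the triangle allows the
  strangers to be exchanged (\<open>exchangeable_triangle\<close>). Elsewhere the person to the right of the pair
  walks through it, the pair is then one step closer to the end, where it is exchanged by
  induction, and the person walks back (\<open>exchangeable_shift\<close>).
\<close>

section \<open>Moves and connectedness\<close>

abbreviation reach_FS ::
  "'a pair_pre_digraph \<Rightarrow> 'b pair_pre_digraph \<Rightarrow> ('a \<Rightarrow> 'b) \<Rightarrow> ('a \<Rightarrow> 'b) \<Rightarrow> bool" where
  "reach_FS X Y \<sigma> \<tau> \<equiv> \<sigma> \<rightarrow>\<^sup>*\<^bsub>with_proj (FS X Y)\<^esub> \<tau>"

lemma pair_graph_arcD:
  assumes "pair_graph G" "(u, v) \<in> parcs G"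
  shows "u \<in> pverts G" "v \<in> pverts G" "u \<noteq> v" "(v, u) \<in> parcs G"
proof -
  interpret G: pair_graph G by fact
  show "u \<in> pverts G" "v \<in> pverts G" "u \<noteq> v"
    using assms(2) G.arc_fst_in_verts[of "(u, v)"] G.arc_snd_in_verts[of "(u, v)"]
      G.pair_no_loops[of "(u, v)"] by auto
  show "(v, u) \<in> parcs G"
    using assms(2) G.pair_sym_arcs by (auto simp: symmetric_def sym_def)
qed

lemma pverts_FS [simp]: "pverts (FS X Y) = bijections (pverts X) (pverts Y)"
  by (simp add: FS_def)

lemma connected_FS_iff:
  assumes "pair_graph X" "pair_graph Y"
  shows "Digraph_Component.connected (with_proj (FS X Y)) \<longleftrightarrow>
    bijections (pverts X) (pverts Y) \<noteq> {} \<and>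
    (\<forall>\<sigma> \<in> bijections (pverts X) (pverts Y). \<forall>\<tau> \<in> bijections (pverts X) (pverts Y).
       reach_FS X Y \<sigma> \<tau>)"
proof -
  interpret F: pair_graph "FS X Y"
    using assms by (rule pair_graph_FS)
  have "u \<rightarrow>\<^sup>*\<^bsub>with_proj (mk_symmetric (with_proj (FS X Y)))\<^esub> v \<longleftrightarrow> reach_FS X Y u v" for u v
    using F.reachable_mk_symmetric_eq F.sym_arcs by blast
  then show ?thesis
    by (simp add: Digraph_Component.connected_def strongly_connected_def)
qed

lemma bijections_comp_permutes:
  assumes "\<sigma> \<in> bijections A B" "p permutes A"
  shows "\<sigma> \<circ> p \<in> bijections A B"
proof -
  have "bij_betw (\<sigma> \<circ> p) A B"
    using assms bij_betw_trans permutes_imp_bij by (fastforce simp: bijections_def)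
  moreover have "(\<sigma> \<circ> p) x = undefined" if "x \<notin> A" for x
    using that assms by (auto simp: bijections_def extensional_def permutes_not_in)
  ultimately show ?thesis
    by (auto simp: bijections_def extensional_def)
qed

lemma bijections_comp_transpose:
  assumes "\<sigma> \<in> bijections A B" "a \<in> A" "b \<in> A"
  shows "\<sigma> \<circ> transpose a b \<in> bijections A B"
  using assms by (intro bijections_comp_permutes permutes_swap_id)

lemma bijections_inj:
  assumes "\<sigma> \<in> bijections A B" "a \<in> A" "b \<in> A"
  shows "\<sigma> a = \<sigma> b \<longleftrightarrow> a = b"
  using assms by (auto simp: bijections_def bij_betw_def inj_on_def)

lemma reach_FS_swap:
  assumes "pair_graph X" "\<sigma> \<in> bijections (pverts X) (pverts Y)"
    and "(a, b) \<in> parcs X" "(\<sigma> a, \<sigma> b) \<in> parcs Y"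
  shows "reach_FS X Y \<sigma> (\<sigma> \<circ> transpose a b)"
proof -
  have "a \<in> pverts X" "b \<in> pverts X"
    using assms(3) pair_graph_arcD(1-2)[OF assms(1)] by blast+
  then have \<tau>: "\<sigma> \<circ> transpose a b \<in> bijections (pverts X) (pverts Y)"
    using assms(2) by (simp add: bijections_comp_transpose)
  have "\<forall>c \<in> pverts X - {a, b}. \<sigma> c = (\<sigma> \<circ> transpose a b) c"
    by simp
  moreover have "\<sigma> a = (\<sigma> \<circ> transpose a b) b" "\<sigma> b = (\<sigma> \<circ> transpose a b) a"
    by simp_all
  ultimately have "(\<sigma>, \<sigma> \<circ> transpose a b) \<in> parcs (FS X Y)"
    using assms(2-4) \<tau> unfolding FS_def pair_pre_digraph.simps mem_Collect_eq prod.case by blast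
  then have "(\<sigma>, \<sigma> \<circ> transpose a b) \<in> arcs_ends (with_proj (FS X Y))"
    by (simp add: with_proj_simps)
  then show ?thesis
    unfolding reachable_def
    by (rule rtrancl_on_into_rtrancl_on[rotated]) (use \<tau> assms(2) in auto)
qed

lemma reach_FS_trans [trans]:
  assumes "reach_FS X Y \<rho> \<sigma>" "reach_FS X Y \<sigma> \<tau>"
  shows "reach_FS X Y \<rho> \<tau>"
  using assms unfolding reachable_def by (rule rtrancl_on_trans)

text \<open>
  A cut argument: a set of arrangements that no move leaves separates its members from all others.
\<close>

lemma reach_FS_closed:
  assumes "reach_FS X Y \<sigma> \<tau>" "P \<sigma>"
    and "\<And>\<rho> \<rho>'. (\<rho>, \<rho>') \<in> parcs (FS X Y) \<Longrightarrow> P \<rho> \<Longrightarrow> P \<rho>'"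
  shows "P \<tau>"
  using assms(1,2) unfolding reachable_def
proof (induction rule: rtrancl_on.induct)
  case (rtrancl_on_refl \<rho>)
  show ?case by fact
next
  case (rtrancl_on_into_rtrancl_on \<rho>1 \<rho> \<rho>')
  then show ?case
    using assms(3)[of \<rho> \<rho>'] by (simp add: with_proj_simps)
qed

section \<open>Exchangeable positions\<close>

text \<open>
  The exchange is required from every arrangement, not from a particular one: this makes exchanges
  composable and lets one be used in the middle of a sequence of moves.
\<close>

definition exchangeable :: "'a pair_pre_digraph \<Rightarrow> 'b pair_pre_digraph \<Rightarrow> 'a \<Rightarrow> 'a \<Rightarrow> bool" where
  "exchangeable X Y a b \<longleftrightarrow>
     (\<forall>\<sigma> \<in> bijections (pverts X) (pverts Y). reach_FS X Y \<sigma> (\<sigma> \<circ> transpose a b))"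

lemma exchangeable_commute: "exchangeable X Y a b \<longleftrightarrow> exchangeable X Y b a"
  by (simp add: exchangeable_def transpose_commute)

text \<open>The transposition of \<open>a\<close> and \<open>c\<close> is the conjugate of that of \<open>a\<close> and \<open>b\<close> by that of
  \<open>b\<close> and \<open>c\<close>.\<close>

lemma exchangeable_trans:
  assumes "exchangeable X Y a b" "exchangeable X Y b c"
    and "a \<in> pverts X" "b \<in> pverts X" "c \<in> pverts X" "a \<noteq> b" "a \<noteq> c"
  shows "exchangeable X Y a c"
  unfolding exchangeable_def
proof
  fix \<sigma> assume \<sigma>: "\<sigma> \<in> bijections (pverts X) (pverts Y)"
  let ?\<sigma>1 = "\<sigma> \<circ> transpose b c" and ?\<sigma>2 = "\<sigma> \<circ> transpose b c \<circ> transpose a b"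
  have "reach_FS X Y \<sigma> ?\<sigma>1"
    using assms(2) \<sigma> by (simp add: exchangeable_def)
  moreover have "?\<sigma>1 \<in> bijections (pverts X) (pverts Y)"
    using \<sigma> assms by (intro bijections_comp_transpose)
  moreover from this assms(3,4) have "?\<sigma>2 \<in> bijections (pverts X) (pverts Y)"
    by (rule bijections_comp_transpose)
  ultimately have "reach_FS X Y \<sigma> (?\<sigma>2 \<circ> transpose b c)"
    using assms(1,2) reach_FS_trans unfolding exchangeable_def by blast
  moreover have "?\<sigma>2 \<circ> transpose b c = \<sigma> \<circ> transpose a c"
    using transpose_comp_triple[of c a b] assms(6,7)
    by (simp add: transpose_commute comp_assoc)
  ultimately show "reach_FS X Y \<sigma> (\<sigma> \<circ> transpose a c)"
    by simp
qed

text \<open>Transpositions generate all permutations of the positions, and any two arrangements differ by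
  such a permutation.\<close>

lemma reach_FS_if_exchangeable:
  assumes fin: "finite (pverts X)"
    and ex: "\<And>a b. a \<in> pverts X \<Longrightarrow> b \<in> pverts X \<Longrightarrow> a \<noteq> b \<Longrightarrow> exchangeable X Y a b"
    and \<sigma>: "\<sigma> \<in> bijections (pverts X) (pverts Y)"
    and \<tau>: "\<tau> \<in> bijections (pverts X) (pverts Y)"
  shows "reach_FS X Y \<sigma> \<tau>"
proof -
  let ?B = "bijections (pverts X) (pverts Y)"
  have perm: "\<forall>\<sigma> \<in> ?B. reach_FS X Y \<sigma> (\<sigma> \<circ> p)" if "p permutes pverts X" for p
    using fin that
  proof (induction rule: permutes_rev_induct)
    case id
    show ?case by (auto simp: reachable_def)
  next
    case (swap a b p)
    have "reach_FS X Y \<sigma> (\<sigma> \<circ> p \<circ> transpose a b)" if "\<sigma> \<in> ?B" for \<sigma>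
      using that swap ex[of a b] bijections_comp_permutes reach_FS_trans
      unfolding exchangeable_def by blast
    then show ?case
      unfolding o_assoc by blast
  qed
  define p where "p x = (if x \<in> pverts X then inv_into (pverts X) \<sigma> (\<tau> x) else x)" for x
  have "bij_betw (inv_into (pverts X) \<sigma> \<circ> \<tau>) (pverts X) (pverts X)"
    using \<sigma> \<tau> by (auto simp: bijections_def intro: bij_betw_trans bij_betw_inv_into)
  then have "bij_betw p (pverts X) (pverts X)"
    by (rule bij_betw_cong[THEN iffD1, rotated]) (simp add: p_def)
  then have "p permutes pverts X"
    by (rule bij_imp_permutes) (simp add: p_def)
  moreover have "\<sigma> \<circ> p = \<tau>"
  proof
    fix x show "(\<sigma> \<circ> p) x = \<tau> x"
    proof (cases "x \<in> pverts X")
      case True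
      then have "\<tau> x \<in> \<sigma> ` pverts X"
        using \<sigma> \<tau> by (auto simp: bijections_def bij_betw_def)
      then show ?thesis
        using True by (simp add: p_def f_inv_into_f)
    next
      case False
      then show ?thesis
        using \<sigma> \<tau> by (simp add: p_def bijections_def extensional_def)
    qed
  qed
  ultimately show ?thesis
    using perm \<sigma> by blast
qed

section \<open>Exchanging strangers\<close>

definition strangers :: "'a pair_pre_digraph \<Rightarrow> 'a \<Rightarrow> 'a set" where
  "strangers Y y = {v \<in> pverts Y - {y}. (y, v) \<notin> parcs Y}"

lemma friend_if_other_stranger:
  assumes "finite (pverts Y)" "card (strangers Y u) \<le> 1" "v \<in> strangers Y u"
    and "w \<in> pverts Y" "w \<noteq> u" "w \<noteq> v"
  shows "(u, w) \<in> parcs Y"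
proof (rule ccontr)
  assume "(u, w) \<notin> parcs Y"
  then have "{v, w} \<subseteq> strangers Y u"
    using assms by (auto simp: strangers_def)
  moreover have "finite (strangers Y u)"
    using assms(1) by (simp add: strangers_def)
  ultimately have "card {v, w} \<le> 1"
    using assms(2) card_mono le_trans by blast
  then show False
    using assms(6) by simp
qed

text \<open>
  It is enough to exchange strangers, and then whoever stands at a third position \<open>c\<close> is a friend
  of both.
\<close>

lemma exchangeableI:
  assumes X: "pair_graph X" and Y: "pair_graph Y"
    and str: "\<And>y. y \<in> pverts Y \<Longrightarrow> card (strangers Y y) \<le> 1"
    and ab: "(a, b) \<in> parcs X" and c: "c \<in> pverts X" "c \<noteq> a" "c \<noteq> b"
    and strange: "\<And>\<sigma>. \<lbrakk>\<sigma> \<in> bijections (pverts X) (pverts Y);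
        (\<sigma> a, \<sigma> c) \<in> parcs Y; (\<sigma> c, \<sigma> a) \<in> parcs Y;
        (\<sigma> b, \<sigma> c) \<in> parcs Y; (\<sigma> c, \<sigma> b) \<in> parcs Y\<rbrakk> \<Longrightarrow> reach_FS X Y \<sigma> (\<sigma> \<circ> transpose a b)"
  shows "exchangeable X Y a b"
  unfolding exchangeable_def
proof
  fix \<sigma> assume \<sigma>: "\<sigma> \<in> bijections (pverts X) (pverts Y)"
  interpret Y: pair_graph Y by fact
  note Ysym = pair_graph_arcD(4)[OF Y]
  have V: "a \<in> pverts X" "b \<in> pverts X" "a \<noteq> b"
    using ab pair_graph_arcD(1-3)[OF X] by blast+
  show "reach_FS X Y \<sigma> (\<sigma> \<circ> transpose a b)"
  proof (cases "(\<sigma> a, \<sigma> b) \<in> parcs Y")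
    case True
    then show ?thesis using X \<sigma> ab by (intro reach_FS_swap)
  next
    case False
    have mem: "\<sigma> a \<in> pverts Y" "\<sigma> b \<in> pverts Y" "\<sigma> c \<in> pverts Y"
      using \<sigma> V c by (auto simp: bijections_def bij_betw_def)
    have neq: "\<sigma> a \<noteq> \<sigma> b" "\<sigma> c \<noteq> \<sigma> a" "\<sigma> c \<noteq> \<sigma> b"
      using V c by (simp_all add: bijections_inj[OF \<sigma>])
    have "\<sigma> b \<in> strangers Y (\<sigma> a)" "\<sigma> a \<in> strangers Y (\<sigma> b)"
      using False Ysym mem neq(1) by (auto simp: strangers_def)
    then have "(\<sigma> a, \<sigma> c) \<in> parcs Y" "(\<sigma> b, \<sigma> c) \<in> parcs Y"
      using friend_if_other_stranger[of Y] str mem neq by auto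
    then show ?thesis
      using strange \<sigma> Ysym by blast
  qed
qed

text \<open>
  Three moves exchange two corners of a triangle. Write \<open>uvw\<close> for the people at \<open>a\<close>, \<open>b\<close>, \<open>c\<close>,
  where \<open>u\<close> and \<open>v\<close> are strangers: \<open>uvw\<close>, \<open>uwv\<close>, \<open>wuv\<close>, \<open>vuw\<close>.
\<close>

lemma exchangeable_triangle:
  assumes X: "pair_graph X" and Y: "pair_graph Y"
    and str: "\<And>y. y \<in> pverts Y \<Longrightarrow> card (strangers Y y) \<le> 1"
    and arcs: "(a, b) \<in> parcs X" "(b, c) \<in> parcs X" "(a, c) \<in> parcs X"
  shows "exchangeable X Y a b"
proof -
  have V: "a \<in> pverts X" "b \<in> pverts X" "c \<in> pverts X" "a \<noteq> b" "a \<noteq> c" "b \<noteq> c"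
    using arcs pair_graph_arcD(1-3)[OF X] by blast+
  show ?thesis
  proof (rule exchangeableI[OF X Y str arcs(1), of c])
    fix \<sigma>
    assume \<sigma>: "\<sigma> \<in> bijections (pverts X) (pverts Y)"
      and f: "(\<sigma> a, \<sigma> c) \<in> parcs Y" "(\<sigma> c, \<sigma> a) \<in> parcs Y"
        "(\<sigma> b, \<sigma> c) \<in> parcs Y" "(\<sigma> c, \<sigma> b) \<in> parcs Y"
    let ?\<sigma>1 = "\<sigma> \<circ> transpose b c" and ?\<sigma>2 = "\<sigma> \<circ> transpose b c \<circ> transpose a b"
    have \<sigma>1: "?\<sigma>1 \<in> bijections (pverts X) (pverts Y)"
      using \<sigma> V by (intro bijections_comp_transpose)
    have \<sigma>2: "?\<sigma>2 \<in> bijections (pverts X) (pverts Y)"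
      using \<sigma>1 V(1,2) by (rule bijections_comp_transpose)
    have "reach_FS X Y \<sigma> ?\<sigma>1"
      using X \<sigma> arcs f by (intro reach_FS_swap)
    also have "reach_FS X Y ?\<sigma>1 ?\<sigma>2"
      using X \<sigma>1 arcs f V by (intro reach_FS_swap) auto
    also have "reach_FS X Y ?\<sigma>2 (?\<sigma>2 \<circ> transpose a c)"
      using X \<sigma>2 arcs f V by (intro reach_FS_swap) auto
    also have "?\<sigma>2 \<circ> transpose a c = \<sigma> \<circ> transpose a b"
    proof
      fix x
      consider "x = a" | "x = b" | "x = c" | "x \<notin> {a, b, c}" by blast
      then show "(?\<sigma>2 \<circ> transpose a c) x = (\<sigma> \<circ> transpose a b) x"
        by cases (use V in simp_all)
    qed
    finally show "reach_FS X Y \<sigma> (\<sigma> \<circ> transpose a b)" .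
  qed (use V in auto)
qed

text \<open>
  In the same notation: \<open>uvw\<close>, \<open>uwv\<close>, \<open>wuv\<close>, then \<open>wvu\<close> by the assumption on \<open>b\<close> and \<open>c\<close>,
  and finally \<open>vwu\<close>, \<open>vuw\<close>.
\<close>

lemma exchangeable_shift:
  assumes X: "pair_graph X" and Y: "pair_graph Y"
    and str: "\<And>y. y \<in> pverts Y \<Longrightarrow> card (strangers Y y) \<le> 1"
    and arcs: "(a, b) \<in> parcs X" "(b, c) \<in> parcs X" and "a \<noteq> c"
    and ex: "exchangeable X Y b c"
  shows "exchangeable X Y a b"
proof -
  have V: "a \<in> pverts X" "b \<in> pverts X" "c \<in> pverts X" "a \<noteq> b" "a \<noteq> c" "b \<noteq> c"
    using arcs \<open>a \<noteq> c\<close> pair_graph_arcD(1-3)[OF X] by blast+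
  show ?thesis
  proof (rule exchangeableI[OF X Y str arcs(1), of c])
    fix \<sigma>
    assume \<sigma>: "\<sigma> \<in> bijections (pverts X) (pverts Y)"
      and f: "(\<sigma> a, \<sigma> c) \<in> parcs Y" "(\<sigma> c, \<sigma> a) \<in> parcs Y"
        "(\<sigma> b, \<sigma> c) \<in> parcs Y" "(\<sigma> c, \<sigma> b) \<in> parcs Y"
    define \<sigma>1 where "\<sigma>1 = \<sigma> \<circ> transpose b c"
    define \<sigma>2 where "\<sigma>2 = \<sigma>1 \<circ> transpose a b"
    define \<sigma>3 where "\<sigma>3 = \<sigma>2 \<circ> transpose b c"
    define \<sigma>4 where "\<sigma>4 = \<sigma>3 \<circ> transpose a b"
    note defs = \<sigma>1_def \<sigma>2_def \<sigma>3_def \<sigma>4_def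
    have "\<sigma>1 \<in> bijections (pverts X) (pverts Y)"
      unfolding \<sigma>1_def using \<sigma> V(2,3) by (rule bijections_comp_transpose)
    moreover from this have "\<sigma>2 \<in> bijections (pverts X) (pverts Y)"
      unfolding \<sigma>2_def using V(1,2) by (rule bijections_comp_transpose)
    moreover from this have "\<sigma>3 \<in> bijections (pverts X) (pverts Y)"
      unfolding \<sigma>3_def using V(2,3) by (rule bijections_comp_transpose)
    moreover from this have "\<sigma>4 \<in> bijections (pverts X) (pverts Y)"
      unfolding \<sigma>4_def using V(1,2) by (rule bijections_comp_transpose)
    ultimately have bij: "\<sigma>1 \<in> bijections (pverts X) (pverts Y)"
        "\<sigma>2 \<in> bijections (pverts X) (pverts Y)" "\<sigma>3 \<in> bijections (pverts X) (pverts Y)"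
        "\<sigma>4 \<in> bijections (pverts X) (pverts Y)"
      by blast+
    have "reach_FS X Y \<sigma> \<sigma>1"
      unfolding \<sigma>1_def using X \<sigma> arcs f by (intro reach_FS_swap)
    also have "reach_FS X Y \<sigma>1 \<sigma>2"
      unfolding \<sigma>2_def using X bij arcs f V by (intro reach_FS_swap) (auto simp: defs)
    also have "reach_FS X Y \<sigma>2 \<sigma>3"
      using ex bij by (simp add: exchangeable_def \<sigma>3_def)
    also have "reach_FS X Y \<sigma>3 \<sigma>4"
      unfolding \<sigma>4_def using X bij arcs f V by (intro reach_FS_swap) (auto simp: defs)
    also have "reach_FS X Y \<sigma>4 (\<sigma>4 \<circ> transpose b c)"
      using X bij arcs f V by (intro reach_FS_swap) (auto simp: defs)
    also have "\<sigma>4 \<circ> transpose b c = \<sigma> \<circ> transpose a b"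
    proof
      fix x
      consider "x = a" | "x = b" | "x = c" | "x \<notin> {a, b, c}" by blast
      then show "(\<sigma>4 \<circ> transpose b c) x = (\<sigma> \<circ> transpose a b) x"
        by cases (use V in \<open>simp_all add: defs\<close>)
    qed
    finally show "reach_FS X Y \<sigma> (\<sigma> \<circ> transpose a b)" .
  qed (use V in auto)
qed

section \<open>The lollipop with a triangular head\<close>

lemma pverts_Lollipop [simp]: "pverts (Lollipop k m) = {1..k + m}"
  by (simp add: Lollipop_def Let_def)

text \<open>The path through all positions, together with one chord closing the triangle.\<close>

lemma parcs_Lollipop_3:
  "(i, j) \<in> parcs (Lollipop k 3) \<longleftrightarrow>
     i \<in> {1..k + 3} \<and> j \<in> {1..k + 3} \<and>
     (j = i + 1 \<or> i = j + 1 \<or> i = k + 1 \<and> j = k + 3 \<or> i = k + 3 \<and> j = k + 1)"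
  unfolding Lollipop_def Let_def by auto

lemma exchangeable_consecutive:
  assumes Y: "pair_graph Y"
    and str: "\<And>y. y \<in> pverts Y \<Longrightarrow> card (strangers Y y) \<le> 1"
    and i: "1 \<le> i" "i \<le> k + 2"
  shows "exchangeable (Lollipop k 3) Y i (i + 1)"
  using i(2)
proof (induction rule: inc_induct)
  case base
  have "exchangeable (Lollipop k 3) Y (k + 2) (k + 3)"
    by (rule exchangeable_triangle[where c = "k + 1"])
      (use Y str in \<open>auto simp: pair_graph_Lollipop parcs_Lollipop_3\<close>)
  then show ?case
    by (simp add: numeral_3_eq_3)
next
  case (step j)
  show ?case
    by (rule exchangeable_shift[where c = "j + 2"])
      (use Y str i step in \<open>auto simp: pair_graph_Lollipop parcs_Lollipop_3\<close>)
qed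

lemma exchangeable_Lollipop_3:
  assumes Y: "pair_graph Y"
    and str: "\<And>y. y \<in> pverts Y \<Longrightarrow> card (strangers Y y) \<le> 1"
    and ij: "1 \<le> i" "i < j" "j \<le> k + 3"
  shows "exchangeable (Lollipop k 3) Y i j"
proof -
  have "i + 1 \<le> j" using ij by simp
  then show ?thesis
    using ij(3)
  proof (induction rule: dec_induct)
    case base
    then show ?case
      using assms by (intro exchangeable_consecutive) auto
  next
    case (step j)
    have "exchangeable (Lollipop k 3) Y j (j + 1)"
      using assms step by (intro exchangeable_consecutive) auto
    then show ?case
      using step ij by (intro exchangeable_trans[of _ _ i j "Suc j"]) auto
  qed
qed

section \<open>Two strangers trapped in the head\<close>

definition left_of_strangers :: "nat \<Rightarrow> 'a \<Rightarrow> 'a set \<Rightarrow> (nat \<Rightarrow> 'a) \<Rightarrow> bool" where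
  "left_of_strangers k y S \<sigma> \<longleftrightarrow>
     (\<exists>p. 1 \<le> p \<and> p \<le> k + 1 \<and> \<sigma> p = y \<and> (\<forall>q \<in> {1..k + 3}. \<sigma> q \<in> S \<longrightarrow> p < q))"

text \<open>
  Only the chord from \<open>k + 1\<close> to \<open>k + 3\<close> jumps over a position, and \<open>y\<close> is never at \<open>k + 2\<close>, so no
  stranger jumps over \<open>y\<close>. For \<open>y\<close> to leave position \<open>k + 1\<close> to the right it would have to trade
  places with \<open>a\<close> or \<open>b\<close>, who fill the two positions there.
\<close>

lemma left_of_strangers_closed:
  assumes arc: "(\<sigma>, \<sigma>') \<in> parcs (FS (Lollipop k 3) Y)"
    and Y: "pair_graph Y"
    and ab: "a \<in> strangers Y y" "b \<in> strangers Y y" "a \<noteq> b"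
    and left: "left_of_strangers k y {a, b} \<sigma>"
  shows "left_of_strangers k y {a, b} \<sigma>'"
proof -
  note Ysym = pair_graph_arcD(4)[OF Y]
  have \<sigma>: "bij_betw \<sigma> {1..k + 3} (pverts Y)"
    using arc by (auto simp: FS_def bijections_def)
  obtain i j where ij: "i < j" "i \<in> {1..k + 3}" "j \<in> {1..k + 3}"
      "j = i + 1 \<or> i = k + 1 \<and> j = k + 3"
    and friends: "(\<sigma> i, \<sigma> j) \<in> parcs Y"
    and swap: "\<sigma>' i = \<sigma> j" "\<sigma>' j = \<sigma> i"
    and rest: "\<And>q. q \<in> {1..k + 3} \<Longrightarrow> q \<noteq> i \<Longrightarrow> q \<noteq> j \<Longrightarrow> \<sigma>' q = \<sigma> q"
  proof -
    from arc obtain i j where *: "(i, j) \<in> parcs (Lollipop k 3)" "(\<sigma> i, \<sigma> j) \<in> parcs Y"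
        "\<sigma> i = \<sigma>' j" "\<sigma> j = \<sigma>' i" "\<forall>c \<in> {1..k + 3} - {i, j}. \<sigma> c = \<sigma>' c"
      by (auto simp: FS_def)
    show thesis
    proof (cases "i < j")
      case True
      then show ?thesis
        using * by (intro that[of i j]) (auto simp: parcs_Lollipop_3)
    next
      case False
      then show ?thesis
        using * Ysym by (intro that[of j i]) (auto simp: parcs_Lollipop_3)
    qed
  qed
  obtain p where p: "1 \<le> p" "p \<le> k + 1" "\<sigma> p = y"
    and pq: "\<And>q. q \<in> {1..k + 3} \<Longrightarrow> \<sigma> q \<in> {a, b} \<Longrightarrow> p < q"
    using left unfolding left_of_strangers_def by blast
  have y: "y \<notin> {a, b}" "(y, a) \<notin> parcs Y" "(y, b) \<notin> parcs Y"
    using ab by (auto simp: strangers_def)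
  consider (still) "p \<noteq> i" "p \<noteq> j" | (right) "p = i" | (left) "p = j"
    by blast
  then show ?thesis
  proof cases
    case still
    have "p < q" if q: "q \<in> {1..k + 3}" "\<sigma>' q \<in> {a, b}" for q
    proof (cases "q = i \<or> q = j")
      case True
      then have "p < i \<or> p < j \<and> q = i"
        using q swap pq[of i] pq[of j] ij by auto
      then show ?thesis
        using True still ij p by auto
    next
      case False
      then show ?thesis
        using q rest pq by auto
    qed
    then show ?thesis
      unfolding left_of_strangers_def using p still rest[of p] by (intro exI[of _ p]) auto
  next
    case right
    have j: "\<sigma> j \<notin> {a, b}"
      using friends right p y by auto
    have "j \<le> k + 1"
    proof (rule ccontr)
      assume "\<not> j \<le> k + 1"
      then have "i = k + 1" "j \<in> {k + 2, k + 3}"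
        using ij p right by auto
      have "a \<in> \<sigma> ` {1..k + 3}" "b \<in> \<sigma> ` {1..k + 3}"
        using \<sigma> ab by (auto simp: strangers_def bij_betw_def)
      then obtain qa qb where q: "qa \<in> {1..k + 3}" "\<sigma> qa = a" "qb \<in> {1..k + 3}" "\<sigma> qb = b"
        by blast
      then have "qa \<in> {k + 2, k + 3}" "qb \<in> {k + 2, k + 3}" "qa \<noteq> qb"
        using pq[of qa] pq[of qb] right \<open>i = k + 1\<close> ab(3) by auto
      then have "j = qa \<or> j = qb"
        using \<open>j \<in> {k + 2, k + 3}\<close> by auto
      then show False
        using j q by auto
    qed
    moreover have "j < q" if q: "q \<in> {1..k + 3}" "\<sigma>' q \<in> {a, b}" for q
    proof -
      have "q \<noteq> i" "q \<noteq> j"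
        using q swap j right p y by auto
      then have "i < q"
        using q rest pq right by auto
      then show ?thesis
        using \<open>q \<noteq> j\<close> ij \<open>j \<le> k + 1\<close> by auto
    qed
    ultimately show ?thesis
      unfolding left_of_strangers_def using p ij swap right by (intro exI[of _ j]) auto
  next
    case left
    have "i < q" if q: "q \<in> {1..k + 3}" "\<sigma>' q \<in> {a, b}" for q
    proof (cases "q = i \<or> q = j")
      case True
      then show ?thesis
        using q swap left p y ij by auto
    next
      case False
      then have "j < q"
        using q rest[of q] pq[of q] left by auto
      then show ?thesis
        using ij by simp
    qed
    then show ?thesis
      unfolding left_of_strangers_def using p ij swap left by (intro exI[of _ i]) auto
  qed
qed

lemma bijection_of_list:
  assumes "distinct zs" "set zs = V" "length zs = n"
  shows "(\<lambda>i \<in> {1..n}. zs ! (i - 1)) \<in> bijections {1..n} V"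
proof -
  have "bij_betw (\<lambda>i. i - 1) {1..n} {..<n}"
    by (rule bij_betwI[where g = Suc]) auto
  moreover have "bij_betw ((!) zs) {..<n} V"
    using assms by (intro bij_betw_nth) auto
  ultimately have "bij_betw ((!) zs \<circ> (\<lambda>i. i - 1)) {1..n} V"
    by (rule bij_betw_trans)
  then have "bij_betw (\<lambda>i \<in> {1..n}. zs ! (i - 1)) {1..n} V"
    by (rule bij_betw_cong[THEN iffD1, rotated]) simp
  then show ?thesis
    by (simp add: bijections_def)
qed

lemma not_connected_if_two_strangers:
  assumes Y: "pair_graph Y" and card: "card (pverts Y) = k + 3"
    and y: "y \<in> pverts Y" and ab: "a \<in> strangers Y y" "b \<in> strangers Y y" "a \<noteq> b"
  shows "\<not> Digraph_Component.connected (with_proj (FS (Lollipop k 3) Y))"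
proof
  assume conn: "Digraph_Component.connected (with_proj (FS (Lollipop k 3) Y))"
  interpret Y: pair_graph Y by fact
  have V: "a \<in> pverts Y" "b \<in> pverts Y" "a \<noteq> y" "b \<noteq> y"
    using ab by (auto simp: strangers_def)
  have L: "pair_graph (Lollipop k 3)"
    by (simp add: pair_graph_Lollipop)
  obtain xs where xs: "set xs = pverts Y - {y, a, b}" "distinct xs"
    using finite_distinct_list[of "pverts Y - {y, a, b}"] by auto
  let ?arr = "\<lambda>zs. \<lambda>i \<in> {1..k + 3}. zs ! (i - 1)"
  have arr: "?arr zs \<in> bijections {1..k + 3} (pverts Y)"
    if "zs = y # a # b # xs \<or> zs = a # y # b # xs" for zs
  proof (rule bijection_of_list)
    show "distinct zs" and zs: "set zs = pverts Y"
      using that xs V ab(3) y by (elim disjE; simp; blast)+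
    then show "length zs = k + 3"
      using card distinct_card by metis
  qed
  have "reach_FS (Lollipop k 3) Y (?arr (y # a # b # xs)) (?arr (a # y # b # xs))"
    using conn arr connected_FS_iff[OF L Y] unfolding pverts_Lollipop by blast
  moreover have "left_of_strangers k y {a, b} (?arr (y # a # b # xs))"
    unfolding left_of_strangers_def
  proof (intro exI[of _ 1] conjI ballI impI)
    fix q assume "q \<in> {1..k + 3}" "?arr (y # a # b # xs) q \<in> {a, b}"
    then show "1 < q"
      using V by (cases "q = 1") auto
  qed auto
  ultimately have "left_of_strangers k y {a, b} (?arr (a # y # b # xs))"
    by (rule reach_FS_closed[where P = "left_of_strangers k y {a, b}"])
      (rule left_of_strangers_closed[OF _ Y ab])
  then obtain p where "1 \<le> p" "\<forall>q \<in> {1..k + 3}. ?arr (a # y # b # xs) q \<in> {a, b} \<longrightarrow> p < q"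
    unfolding left_of_strangers_def by blast
  from this(1) this(2)[rule_format, of 1] show False
    by simp
qed

section \<open>Degrees and the characterisation\<close>

lemma out_degree_strangers:
  assumes "pair_graph Y" "y \<in> pverts Y"
  shows "out_degree (with_proj Y) y + card (strangers Y y) + 1 = card (pverts Y)"
proof -
  interpret Y: pair_graph Y by fact
  let ?N = "{v. (y, v) \<in> parcs Y}"
  have "out_arcs (with_proj Y) y = Pair y ` ?N"
    by (auto simp: out_arcs_def)
  then have deg: "out_degree (with_proj Y) y = card ?N"
    by (simp add: out_degree_def card_image inj_on_def)
  have sub: "?N \<subseteq> pverts Y - {y}"
    using pair_graph_arcD(2,3)[OF assms(1)] by blast
  then have "finite ?N"
    by (rule finite_subset) simp
  moreover have "pverts Y - {y} = ?N \<union> strangers Y y" "?N \<inter> strangers Y y = {}"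
    using sub by (auto simp: strangers_def)
  moreover have "finite (strangers Y y)"
    by (simp add: strangers_def)
  ultimately have "card (pverts Y - {y}) = card ?N + card (strangers Y y)"
    by (simp add: card_Un_disjoint)
  then show ?thesis
    using deg assms(2) by (metis Suc_eq_plus1 Y.pair_finite_verts card_Suc_Diff1)
qed

lemma min_degree_iff_strangers:
  assumes Y: "pair_graph Y" and "card (pverts Y) \<ge> 2"
  shows "min_degree Y \<ge> card (pverts Y) - 2 \<longleftrightarrow> (\<forall>y \<in> pverts Y. card (strangers Y y) \<le> 1)"
proof -
  interpret Y: pair_graph Y by fact
  have "pverts Y \<noteq> {}" using assms(2) by auto
  then have "min_degree Y \<ge> card (pverts Y) - 2 \<longleftrightarrow>
      (\<forall>y \<in> pverts Y. out_degree (with_proj Y) y \<ge> card (pverts Y) - 2)"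
    by (simp add: min_degree_def)
  moreover have "out_degree (with_proj Y) y \<ge> card (pverts Y) - 2 \<longleftrightarrow> card (strangers Y y) \<le> 1"
    if "y \<in> pverts Y" for y
    using out_degree_strangers[OF Y that] assms(2) by linarith
  ultimately show ?thesis
    by simp
qed

theorem corollary6p3:
  fixes Y :: "'a pair_pre_digraph" and n :: nat
  assumes "pair_graph Y"
    and "card (pverts Y) = n"
    and "n \<ge> 3"
  shows "Digraph_Component.connected (with_proj (FS (Lollipop (n - 3) 3) Y)) \<longleftrightarrow> min_degree Y \<ge> n - 2"
proof -
  interpret Y: pair_graph Y by fact
  obtain k where n: "n = k + 3"
    using assms(3) by (metis add.commute le_Suc_ex)
  let ?L = "Lollipop k 3"
  have L: "pair_graph ?L"
    by (simp add: pair_graph_Lollipop)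
  have "Digraph_Component.connected (with_proj (FS ?L Y)) \<longleftrightarrow>
      (\<forall>y \<in> pverts Y. card (strangers Y y) \<le> 1)"
  proof
    assume conn: "Digraph_Component.connected (with_proj (FS ?L Y))"
    show "\<forall>y \<in> pverts Y. card (strangers Y y) \<le> 1"
    proof (rule ballI, rule ccontr)
      have card: "card (pverts Y) = k + 3"
        using assms(2) n by simp
      fix y assume y: "y \<in> pverts Y" "\<not> card (strangers Y y) \<le> 1"
      have "finite (strangers Y y)"
        by (simp add: strangers_def)
      then obtain a b where "a \<in> strangers Y y" "b \<in> strangers Y y" "a \<noteq> b"
        using y(2) card_le_Suc0_iff_eq unfolding One_nat_def by blast
      then show False
        using conn not_connected_if_two_strangers[OF assms(1) card y(1)] by blast
    qed
  next
    assume str: "\<forall>y \<in> pverts Y. card (strangers Y y) \<le> 1"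
    have ex: "exchangeable ?L Y i j" if "i \<in> pverts ?L" "j \<in> pverts ?L" "i \<noteq> j" for i j
    proof (cases "i < j")
      case True
      then show ?thesis
        using that str assms(1) by (intro exchangeable_Lollipop_3) auto
    next
      case False
      then have "exchangeable ?L Y j i"
        using that str assms(1) by (intro exchangeable_Lollipop_3) auto
      then show ?thesis
        by (simp add: exchangeable_commute)
    qed
    obtain zs where "distinct zs" "set zs = pverts Y"
      using finite_distinct_list[of "pverts Y"] by auto
    moreover from this have "length zs = k + 3"
      using assms(2) n distinct_card by metis
    ultimately have "bijections (pverts ?L) (pverts Y) \<noteq> {}"
      using bijection_of_list[of zs "pverts Y" "k + 3"] by auto
    then show "Digraph_Component.connected (with_proj (FS ?L Y))"
      using reach_FS_if_exchangeable[OF _ ex] by (simp add: connected_FS_iff L assms(1))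
  qed
  then show ?thesis
    using min_degree_iff_strangers[OF assms(1)] assms(2) n by simp
qed

end
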